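(* Let $(R,\triangleright)$ be a rack and $(\overline{R},* )$ be its corresponding quandle. Then the map $Q\mapsto\overline{Q}$ defines a lattice isomorphism from $\mathcal{R}(R)$ to $\mathcal{R}(\overline{R})$.
   Context: A rack is a set $R$ with a binary operation $\triangleright$ such that (i) $a\triangleright(b\triangleright c)=(a\triangleright b)\triangleright(a\triangleright c)$ for all $a,b,c\in R$, and (ii) for all $a,b\in R$ there is a unique $c\in R$ with $a\triangleright c=b$. A quandle is a rack in which $a\triangleright a=a$ for all $a$. A subset $Q\subseteq R$ is a subrack if $(Q,\triangleright)$ is a rack; the empty set counts as a subrack. $\mathcal{R}(R)$ is the lattice of all subracks of $R$ ordered by inclusion. For $a\in R$, $\ll a\gg$ denotes the intersection of all subracks of $R$ containing $a$. Define the equivalence relation $a\sim b$ on $R$ by $\ll a\gg=\ll b\gg$, and let $\overline{a}$ denote the class of $a$. For $A\subseteq R$ put $\overline{A}=\{\overline{a}:\ a\in A\}$. The corresponding quandle of $R$ is the set $\overline{R}$ with the (well-defined) operation $\overline{a}*\overline{b}=\overline{a\triangleright b}$; it is a quandle. *)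

theory Defs
  imports "HOL-Algebra.Lattice"
begin

text \<open>Racks have an explicit carrier, which may be empty; the first conjunct says that
  the operation is a binary operation on the carrier.\<close>

definition rack :: "'a set \<Rightarrow> ('a \<Rightarrow> 'a \<Rightarrow> 'a) \<Rightarrow> bool" where
  "rack R f \<longleftrightarrow>
     (\<forall>a\<in>R. \<forall>b\<in>R. f a b \<in> R) \<and>
     (\<forall>a\<in>R. \<forall>b\<in>R. \<forall>c\<in>R. f a (f b c) = f (f a b) (f a c)) \<and>
     (\<forall>a\<in>R. \<forall>b\<in>R. \<exists>!c. c \<in> R \<and> f a c = b)"

definition quandle :: "'a set \<Rightarrow> ('a \<Rightarrow> 'a \<Rightarrow> 'a) \<Rightarrow> bool" where
  "quandle R f \<longleftrightarrow> rack R f \<and> (\<forall>a\<in>R. f a a = a)"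

definition subracks :: "'a set \<Rightarrow> ('a \<Rightarrow> 'a \<Rightarrow> 'a) \<Rightarrow> 'a set set" where
  "subracks R f = {Q. Q \<subseteq> R \<and> rack Q f}"

definition subrack_lattice :: "'a set \<Rightarrow> ('a \<Rightarrow> 'a \<Rightarrow> 'a) \<Rightarrow> 'a set gorder" where
  "subrack_lattice R f = \<lparr>carrier = subracks R f, eq = (=), le = (\<subseteq>)\<rparr>"

definition gen_subrack :: "'a set \<Rightarrow> ('a \<Rightarrow> 'a \<Rightarrow> 'a) \<Rightarrow> 'a \<Rightarrow> 'a set" where
  "gen_subrack R f a = \<Inter>{Q \<in> subracks R f. a \<in> Q}"

text \<open>The class of \<open>a\<close> is \<open>rack_rel R f `` {a}\<close>, and for a subset \<open>A\<close> of \<open>R\<close> the quotient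
  \<open>A // rack_rel R f\<close> is the set of the classes, taken in \<open>R\<close>, of the elements of \<open>A\<close>.\<close>

definition rack_rel :: "'a set \<Rightarrow> ('a \<Rightarrow> 'a \<Rightarrow> 'a) \<Rightarrow> ('a \<times> 'a) set" where
  "rack_rel R f = {(a, b). a \<in> R \<and> b \<in> R \<and> gen_subrack R f a = gen_subrack R f b}"

definition quandle_carrier :: "'a set \<Rightarrow> ('a \<Rightarrow> 'a \<Rightarrow> 'a) \<Rightarrow> 'a set set" where
  "quandle_carrier R f = R // rack_rel R f"

text \<open>All the sets in the following union coincide if \<open>X\<close> and \<open>Y\<close> are classes; see
  \<open>quandle_op_class\<close> below.\<close>

definition quandle_op :: "'a set \<Rightarrow> ('a \<Rightarrow> 'a \<Rightarrow> 'a) \<Rightarrow> 'a set \<Rightarrow> 'a set \<Rightarrow> 'a set" where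
  "quandle_op R f X Y = (\<Union>a\<in>X. \<Union>b\<in>Y. rack_rel R f `` {f a b})"

definition lattice_iso ::
    "('a, 'c) gorder_scheme \<Rightarrow> ('b, 'd) gorder_scheme \<Rightarrow> ('a \<Rightarrow> 'b) \<Rightarrow> bool" where
  "lattice_iso X Y h \<longleftrightarrow>
     bij_betw h (carrier X) (carrier Y) \<and> join_pres X Y h \<and> meet_pres X Y h"

lemma equiv_rack_rel: "equiv R (rack_rel R f)"
  unfolding equiv_def refl_on_def sym_def trans_def rack_rel_def by auto

lemma rack_closed: "rack R f \<Longrightarrow> a \<in> R \<Longrightarrow> b \<in> R \<Longrightarrow> f a b \<in> R"
  unfolding rack_def by blast

lemma rack_distrib:
  "rack R f \<Longrightarrow> a \<in> R \<Longrightarrow> b \<in> R \<Longrightarrow> c \<in> R \<Longrightarrow> f a (f b c) = f (f a b) (f a c)"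
  unfolding rack_def by blast

lemma rack_ex1: "rack R f \<Longrightarrow> a \<in> R \<Longrightarrow> b \<in> R \<Longrightarrow> \<exists>!c. c \<in> R \<and> f a c = b"
  unfolding rack_def by blast

lemma rack_inj:
  assumes R: "rack R f" and a: "a \<in> R" and b: "b \<in> R" and c: "c \<in> R" and e: "f a b = f a c"
  shows "b = c"
  using rack_ex1[OF R a rack_closed[OF R a c]] b c e by blast

lemma rack_surj:
  assumes "rack R f" "a \<in> R" "b \<in> R"
  obtains c where "c \<in> R" "f a c = b"
  using rack_ex1[OF assms] by blast

lemma rack_subset:
  assumes R: "rack R f" and Q: "Q \<subseteq> R"
    and cl: "\<And>a b. a \<in> Q \<Longrightarrow> b \<in> Q \<Longrightarrow> f a b \<in> Q"
    and ex: "\<And>a b. a \<in> Q \<Longrightarrow> b \<in> R \<Longrightarrow> f a b \<in> Q \<Longrightarrow> b \<in> Q"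
  shows "rack Q f"
  unfolding rack_def
proof (intro conjI ballI)
  fix a b assume ab: "a \<in> Q" "b \<in> Q"
  then obtain c where c: "c \<in> R" "f a c = b"
    using rack_surj[OF R, of a b] Q by blast
  then have "c \<in> Q" using ex[OF ab(1) c(1)] ab by simp
  then show "\<exists>!c. c \<in> Q \<and> f a c = b"
    using c rack_inj[OF R] Q ab by (intro ex1I[of _ c]) blast+
next
  fix a b c assume "a \<in> Q" "b \<in> Q" "c \<in> Q"
  then show "f a (f b c) = f (f a b) (f a c)" using rack_distrib[OF R] Q by blast
qed (rule cl)

lemma gen_subrack_self: "a \<in> gen_subrack R f a"
  by (simp add: gen_subrack_def)

lemma gen_subrack_le: "Q \<in> subracks R f \<Longrightarrow> a \<in> Q \<Longrightarrow> gen_subrack R f a \<subseteq> Q"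
  by (auto simp: gen_subrack_def)

lemma subrack_cancel:
  assumes "rack R f" "Q \<in> subracks R f" "a \<in> Q" "b \<in> R" "f a b \<in> Q"
  shows "b \<in> Q"
proof -
  have Q: "rack Q f" "Q \<subseteq> R" using assms(2) by (auto simp: subracks_def)
  obtain c where c: "c \<in> Q" "f a c = f a b" using rack_surj[OF Q(1) assms(3,5)] .
  have "c = b" using rack_inj[OF assms(1) _ _ assms(4) c(2)] assms(3) c(1) Q(2) by blast
  then show ?thesis using c(1) by simp
qed

lemma gen_subrack_mem:
  assumes R: "rack R f" and a: "a \<in> R"
  shows "gen_subrack R f a \<in> subracks R f"
proof -
  have "R \<in> subracks R f" using R by (simp add: subracks_def)
  then have "gen_subrack R f a \<subseteq> R" using a by (rule gen_subrack_le)
  moreover have "rack (gen_subrack R f a) f"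
  proof (rule rack_subset[OF R \<open>gen_subrack R f a \<subseteq> R\<close>])
    fix x y assume "x \<in> gen_subrack R f a" "y \<in> gen_subrack R f a"
    then show "f x y \<in> gen_subrack R f a"
      by (auto simp: gen_subrack_def subracks_def dest: rack_closed)
  next
    fix x y assume "x \<in> gen_subrack R f a" "y \<in> R" "f x y \<in> gen_subrack R f a"
    then show "y \<in> gen_subrack R f a"
      using subrack_cancel[OF R, of _ x y] by (auto simp: gen_subrack_def)
  qed
  ultimately show ?thesis by (simp add: subracks_def)
qed

lemma left_mult_cong:
  assumes R: "rack R f" and aa: "(a, a') \<in> rack_rel R f" and y: "y \<in> R"
  shows "f a y = f a' y"
proof -
  have a: "a \<in> R" "a' \<in> R" and eq: "gen_subrack R f a = gen_subrack R f a'"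
    using aa by (auto simp: rack_rel_def)
  let ?S = "{x \<in> R. \<forall>y\<in>R. f x y = f a y}"
  have "rack ?S f"
  proof (rule rack_subset[OF R])
    have main: "(\<forall>y\<in>R. f (f u v) y = f a y) \<longleftrightarrow> (\<forall>y\<in>R. f v y = f a y)"
      if u: "u \<in> ?S" and v: "v \<in> R" for u v
    proof -
      have uR: "u \<in> R" and ua: "\<And>y. y \<in> R \<Longrightarrow> f u y = f a y" using u by auto
      have *: "f (f u v) (f u w) = f u (f v w)" if "w \<in> R" for w
        using rack_distrib[OF R uR v that] by (rule sym)
      have **: "f a (f u w) = f u (f a w)" if w: "w \<in> R" for w
      proof -
        have "f u (f a w) = f a (f a w)" using ua[OF rack_closed[OF R a(1) w]] .
        then show ?thesis by (simp only: ua[OF w])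
      qed
      show ?thesis
      proof
        assume l: "\<forall>y\<in>R. f (f u v) y = f a y"
        show "\<forall>y\<in>R. f v y = f a y"
        proof
          fix w assume w: "w \<in> R"
          have "f u (f v w) = f u (f a w)"
            using *[OF w] **[OF w] l[rule_format, OF rack_closed[OF R uR w]] by metis
          then show "f v w = f a w"
            using rack_inj[OF R uR] rack_closed[OF R v w] rack_closed[OF R a(1) w] by blast
        qed
      next
        assume r: "\<forall>y\<in>R. f v y = f a y"
        show "\<forall>y\<in>R. f (f u v) y = f a y"
        proof
          fix y assume "y \<in> R"
          then obtain w where w: "w \<in> R" "f u w = y" using rack_surj[OF R uR] by blast
          have "f v w = f a w" using r w(1) by blast
          then have "f (f u v) (f u w) = f a (f u w)"
            by (simp only: *[OF w(1)] **[OF w(1)])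
          then show "f (f u v) y = f a y" by (simp only: w(2))
        qed
      qed
    qed
    show "f u v \<in> ?S" if "u \<in> ?S" "v \<in> ?S" for u v
    proof -
      have m: "u \<in> R" "v \<in> R" and h: "\<forall>y\<in>R. f v y = f a y" using that by blast+
      show ?thesis using rack_closed[OF R m] main[OF that(1) m(2)] h by blast
    qed
    show "v \<in> ?S" if "u \<in> ?S" "v \<in> R" "f u v \<in> ?S" for u v
    proof -
      have h: "\<forall>y\<in>R. f (f u v) y = f a y" using that(3) by blast
      show ?thesis using that(2) main[OF that(1,2)] h by blast
    qed
  qed blast
  then have "?S \<in> subracks R f" unfolding subracks_def by blast
  moreover have "a \<in> ?S" using a by blast
  ultimately have "gen_subrack R f a \<subseteq> ?S" by (rule gen_subrack_le)
  then have "a' \<in> ?S" using eq gen_subrack_self[of a' R f] by blast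
  then have "f a' y = f a y" using y by blast
  then show ?thesis by (rule sym)
qed

lemma subrack_act:
  assumes R: "rack R f" and a: "a \<in> R" and Q: "Q \<in> subracks R f"
  shows "f a ` Q \<in> subracks R f" "{x \<in> R. f a x \<in> Q} \<in> subracks R f"
proof -
  have QR: "Q \<subseteq> R" and rQ: "rack Q f" using Q by (auto simp: subracks_def)
  have "rack (f a ` Q) f"
  proof (rule rack_subset[OF R])
    show "f a ` Q \<subseteq> R" using QR rack_closed[OF R a] by blast
    show "f u v \<in> f a ` Q" if uv: "u \<in> f a ` Q" "v \<in> f a ` Q" for u v
    proof -
      obtain x y where "x \<in> Q" "y \<in> Q" "u = f a x" "v = f a y" using uv by blast
      then show ?thesis
        using rack_distrib[OF R a, of x y] QR rack_closed[OF rQ, of x y] by (metis imageI subsetD)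
    qed
    show "v \<in> f a ` Q" if u: "u \<in> f a ` Q" and v: "v \<in> R" and uv: "f u v \<in> f a ` Q" for u v
    proof -
      obtain x z where x: "x \<in> Q" "u = f a x" and z: "z \<in> Q" "f u v = f a z" using u uv by blast
      obtain y where y: "y \<in> R" "f a y = v" using rack_surj[OF R a v] by blast
      have "f a (f x y) = f a z" using rack_distrib[OF R a, of x y] x y z QR by auto
      then have "f x y = z"
        using rack_inj[OF R a] rack_closed[OF R] x y z QR by (meson subsetD)
      then have "y \<in> Q" using subrack_cancel[OF R Q x(1) y(1)] z by simp
      then show ?thesis using y by blast
    qed
  qed
  then show "f a ` Q \<in> subracks R f"
    using QR rack_closed[OF R a] by (auto simp: subracks_def)
  have "rack {x \<in> R. f a x \<in> Q} f"
  proof (rule rack_subset[OF R])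
    show "f u v \<in> {x \<in> R. f a x \<in> Q}"
      if "u \<in> {x \<in> R. f a x \<in> Q}" "v \<in> {x \<in> R. f a x \<in> Q}" for u v
      using that rack_distrib[OF R a, of u v] rack_closed[OF R] rack_closed[OF rQ] by auto
    show "v \<in> {x \<in> R. f a x \<in> Q}"
      if "u \<in> {x \<in> R. f a x \<in> Q}" "v \<in> R" "f u v \<in> {x \<in> R. f a x \<in> Q}" for u v
      using that rack_distrib[OF R a, of u v] rack_closed[OF R a, of v]
        subrack_cancel[OF R Q, of "f a u" "f a v"] by auto
  qed auto
  then show "{x \<in> R. f a x \<in> Q} \<in> subracks R f" by (auto simp: subracks_def)
qed

lemma gen_subrack_op:
  assumes R: "rack R f" and a: "a \<in> R" and b: "b \<in> R"
  shows "gen_subrack R f (f a b) = f a ` gen_subrack R f b"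
proof
  show "gen_subrack R f (f a b) \<subseteq> f a ` gen_subrack R f b"
    using subrack_act(1)[OF R a gen_subrack_mem[OF R b]] gen_subrack_self[of b R f]
    by (intro gen_subrack_le) auto
  have "gen_subrack R f b \<subseteq> {x \<in> R. f a x \<in> gen_subrack R f (f a b)}"
    using subrack_act(2)[OF R a gen_subrack_mem[OF R rack_closed[OF R a b]]]
      gen_subrack_self[of "f a b" R f] b
    by (intro gen_subrack_le) auto
  then show "f a ` gen_subrack R f b \<subseteq> gen_subrack R f (f a b)" by blast
qed

lemma rack_rel_cong:
  assumes R: "rack R f" and aa: "(a, a') \<in> rack_rel R f" and bb: "(b, b') \<in> rack_rel R f"
  shows "(f a b, f a' b') \<in> rack_rel R f"
proof -
  have m: "a \<in> R" "a' \<in> R" "b \<in> R" "b' \<in> R"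
    and eb: "gen_subrack R f b = gen_subrack R f b'"
    using aa bb by (auto simp: rack_rel_def)
  have "gen_subrack R f b' \<subseteq> R" using gen_subrack_mem[OF R m(4)] by (simp add: subracks_def)
  then have "f a ` gen_subrack R f b' = f a' ` gen_subrack R f b'"
    using left_mult_cong[OF R aa] by (intro image_cong) auto
  then show ?thesis
    using m eb rack_closed[OF R] by (simp add: rack_rel_def gen_subrack_op[OF R])
qed

lemma quandle_op_class:
  assumes R: "rack R f" and a: "a \<in> R" and b: "b \<in> R"
  shows "quandle_op R f (rack_rel R f `` {a}) (rack_rel R f `` {b}) = rack_rel R f `` {f a b}"
proof -
  have "congruent2 (rack_rel R f) (rack_rel R f) (\<lambda>a b. rack_rel R f `` {f a b})"
    by (intro congruent2I') (rule equiv_class_eq[OF equiv_rack_rel rack_rel_cong[OF R]])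
  from UN_equiv_class2[OF equiv_rack_rel equiv_rack_rel this a b]
  show ?thesis unfolding quandle_op_def .
qed

lemma rack_rel_diag:
  assumes R: "rack R f" and a: "a \<in> R"
  shows "(f a a, a) \<in> rack_rel R f"
proof -
  have aa: "f a a \<in> R" using rack_closed[OF R a a] .
  have sub: "gen_subrack R f a \<in> subracks R f" using gen_subrack_mem[OF R a] .
  have in1: "f a a \<in> gen_subrack R f a"
    using sub gen_subrack_self[of a R f] rack_closed by (fastforce simp: subracks_def)
  have sub2: "gen_subrack R f (f a a) \<in> subracks R f" using gen_subrack_mem[OF R aa] .
  have eq: "f (f a a) (f a a) = f a (f a a)" using rack_distrib[OF R a a a] by simp
  have in2: "a \<in> gen_subrack R f (f a a)"
  proof -
    let ?S = "gen_subrack R f (f a a)"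
    have s: "f a a \<in> ?S" "rack ?S f" "?S \<subseteq> R"
      using gen_subrack_self[of "f a a" R f] sub2 by (auto simp: subracks_def)
    obtain c where c: "c \<in> ?S" "f (f a a) c = f a a" using rack_surj[OF s(2) s(1) s(1)] by blast
    obtain d where d: "d \<in> R" "f a d = c" using rack_surj[OF R a] c s by blast
    have "f a (f a d) = f (f a a) (f a d)" using rack_distrib[OF R a a d(1)] .
    then have "f a c = f a a" using c d by simp
    then have "c = a" using rack_inj[OF R a] c a s by blast
    then show ?thesis using c by simp
  qed
  show ?thesis
    using gen_subrack_le[OF sub in1] gen_subrack_le[OF sub2 in2] a aa by (auto simp: rack_rel_def)
qed

lemma quandle_quotient:
  assumes R: "rack R f"
  shows "quandle (quandle_carrier R f) (quandle_op R f)"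
proof -
  let ?c = "\<lambda>a. rack_rel R f `` {a}"
  have car: "quandle_carrier R f = ?c ` R" by (auto simp: quandle_carrier_def quotient_def)
  note op = quandle_op_class[OF R]
  have eqc: "?c x = ?c y \<longleftrightarrow> gen_subrack R f x = gen_subrack R f y" if "x \<in> R" "y \<in> R" for x y
    using eq_equiv_class_iff[OF equiv_rack_rel that, of f] that by (simp add: rack_rel_def)
  have canc: "?c b = ?c c" if m: "a \<in> R" "b \<in> R" "c \<in> R" and e: "?c (f a b) = ?c (f a c)" for a b c
  proof -
    have "f a ` gen_subrack R f b = f a ` gen_subrack R f c"
      using e m eqc rack_closed[OF R] by (simp add: gen_subrack_op[OF R])
    moreover have "inj_on (f a) R" using rack_inj[OF R m(1)] by (auto intro: inj_onI)
    moreover have "gen_subrack R f b \<subseteq> R" "gen_subrack R f c \<subseteq> R"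
      using gen_subrack_mem[OF R] m by (auto simp: subracks_def)
    ultimately show ?thesis using inj_on_image_eq_iff eqc m by metis
  qed
  have "rack (?c ` R) (quandle_op R f)"
    unfolding rack_def
  proof (intro conjI ballI)
    fix X Y assume "X \<in> ?c ` R" "Y \<in> ?c ` R"
    then obtain a b where X: "a \<in> R" "X = ?c a" and Y: "b \<in> R" "Y = ?c b" by blast
    show "quandle_op R f X Y \<in> ?c ` R" using X Y rack_closed[OF R] by (simp add: op)
    obtain c where c: "c \<in> R" "f a c = b" using rack_surj[OF R X(1) Y(1)] .
    show "\<exists>!Z. Z \<in> ?c ` R \<and> quandle_op R f X Z = Y"
    proof (rule ex1I[of _ "?c c"])
      show "?c c \<in> ?c ` R \<and> quandle_op R f X (?c c) = Y" using X Y c by (simp add: op)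
      fix Z assume Z: "Z \<in> ?c ` R \<and> quandle_op R f X Z = Y"
      then obtain d where d: "d \<in> R" "Z = ?c d" by blast
      then have "?c (f a d) = ?c (f a c)" using Z X Y c by (simp add: op)
      then show "Z = ?c c" using canc[OF X(1) d(1) c(1)] d by simp
    qed
  next
    fix X Y Z assume "X \<in> ?c ` R" "Y \<in> ?c ` R" "Z \<in> ?c ` R"
    then obtain a b c
      where m: "a \<in> R" "b \<in> R" "c \<in> R" and e: "X = ?c a" "Y = ?c b" "Z = ?c c" by blast
    then show "quandle_op R f X (quandle_op R f Y Z)
        = quandle_op R f (quandle_op R f X Y) (quandle_op R f X Z)"
      using rack_distrib[OF R m] by (simp add: e m op rack_closed[OF R])
  qed
  moreover have "quandle_op R f X X = X" if XR: "X \<in> ?c ` R" for X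
  proof -
    obtain a where a: "a \<in> R" "X = ?c a" using XR by blast
    then show ?thesis
      using equiv_class_eq[OF equiv_rack_rel rack_rel_diag[OF R a(1)]] by (simp add: op)
  qed
  ultimately show ?thesis by (simp add: quandle_def car)
qed

end

theory Submission
  imports Defs
begin

text \<open>Every subrack \<open>Q\<close> of \<open>R\<close> is a union of classes: if \<open>a \<in> Q\<close> and \<open>a \<sim> b\<close>, then
  \<open>b\<close> lies in \<open>gen_subrack R f b = gen_subrack R f a \<subseteq> Q\<close> (\<open>subrack_saturated\<close>).  Passing to the quotient therefore loses
  nothing: saturated subsets of \<open>R\<close> correspond to subsets of the quotient, with union of classes
  as the inverse map, and inclusion is preserved and reflected.  As the projection
  \<open>a \<mapsto> [a]\<close> is a homomorphism onto a rack, a saturated set is closed under the operation and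
  under left division iff its image is, so subracks correspond to subracks
  (\<open>saturated_subrack_iff\<close>).

  This gives an isomorphism of ordered sets.  Both sides are lattices because subracks are closed
  under intersection, and an isomorphism of ordered sets between lattices preserves
  joins and meets (\<open>order_iso_lattice_iso\<close>).\<close>

section \<open>The lattice of subracks\<close>

text \<open>Unlike the definition, this form has no existence statement in it, which makes closure under
  intersections and the comparison of \<open>R\<close> with its quotient immediate.\<close>

lemma subracks_iff:
  assumes R: "rack R f"
  shows "Q \<in> subracks R f \<longleftrightarrow>
    Q \<subseteq> R \<and> (\<forall>a\<in>Q. \<forall>b\<in>Q. f a b \<in> Q) \<and> (\<forall>a\<in>Q. \<forall>b\<in>R. f a b \<in> Q \<longrightarrow> b \<in> Q)"
    (is "_ \<longleftrightarrow> ?rhs")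
proof
  assume Q: "Q \<in> subracks R f"
  then have "Q \<subseteq> R" "rack Q f"
    by (simp_all add: subracks_def)
  then show ?rhs
    using subrack_cancel[OF R Q] rack_closed[of Q f] by blast
next
  assume ?rhs
  then show "Q \<in> subracks R f"
    using rack_subset[OF R, of Q] unfolding subracks_def by blast
qed

lemma subracks_Inter:
  assumes "rack R f" "S \<subseteq> subracks R f" "S \<noteq> {}"
  shows "\<Inter>S \<in> subracks R f"
  using assms(2,3) unfolding subracks_iff[OF assms(1)] subset_iff by blast

lemma lattice_subrack_lattice:
  assumes R: "rack R f"
  shows "lattice (subrack_lattice R f)"
proof -
  let ?L = "subrack_lattice R f"
  have carrier: "carrier ?L = subracks R f"
    by (simp add: subrack_lattice_def)
  interpret partial_order ?L
    by unfold_locales (auto simp: subrack_lattice_def)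
  show ?thesis
  proof
    fix P Q assume "P \<in> carrier ?L" "Q \<in> carrier ?L"
    then have PQ: "P \<in> subracks R f" "Q \<in> subracks R f"
      by (simp_all add: carrier)
    let ?U = "{S \<in> subracks R f. P \<union> Q \<subseteq> S}"
    \<comment> \<open>\<open>R\<close> itself is an upper bound, so the intersection is over a nonempty family.\<close>
    have "R \<in> ?U"
      using R PQ by (auto simp: subracks_def)
    then have "\<Inter>?U \<in> subracks R f"
      by (intro subracks_Inter[OF R]) auto
    then have "least ?L (\<Inter>?U) (Upper ?L {P, Q})"
      using PQ by (auto simp: least_def Upper_def subrack_lattice_def)
    then show "\<exists>s. least ?L s (Upper ?L {P, Q})" ..
    have "P \<inter> Q \<in> subracks R f"
      using subracks_Inter[OF R, of "{P, Q}"] PQ by simp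
    then have "greatest ?L (P \<inter> Q) (Lower ?L {P, Q})"
      using PQ by (auto simp: greatest_def Lower_def subrack_lattice_def)
    then show "\<exists>s. greatest ?L s (Lower ?L {P, Q})" ..
  qed
qed

section \<open>Order isomorphisms of lattices\<close>

text \<open>Joins and meets are determined by the order.  One inequality in each case is monotonicity of
  \<open>h\<close>; for the other, pull the join or meet in \<open>Y\<close> back along the surjection \<open>h\<close>.\<close>

lemma order_iso_lattice_iso:
  assumes X: "lattice X" and Y: "lattice Y"
    and bij: "bij_betw h (carrier X) (carrier Y)"
    and le_iff: "\<And>x y. x \<in> carrier X \<Longrightarrow> y \<in> carrier X \<Longrightarrow> h x \<sqsubseteq>\<^bsub>Y\<^esub> h y \<longleftrightarrow> x \<sqsubseteq>\<^bsub>X\<^esub> y"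
  shows "lattice_iso X Y h"
proof -
  have closed: "h x \<in> carrier Y" if "x \<in> carrier X" for x
    using bij that by (rule bij_betw_apply)
  have preimage: "\<exists>z\<in>carrier X. h z = w" if "w \<in> carrier Y" for w
    using that bij_betw_imp_surj_on[OF bij, symmetric] by auto
  interpret X: lattice X by (rule X)
  interpret Y: lattice Y by (rule Y)
  have "h (x \<squnion>\<^bsub>X\<^esub> y) = h x \<squnion>\<^bsub>Y\<^esub> h y"
    if x: "x \<in> carrier X" and y: "y \<in> carrier X" for x y
  proof -
    have xy: "x \<squnion>\<^bsub>X\<^esub> y \<in> carrier X"
      using x y by (rule X.join_closed)
    have hxy: "h x \<squnion>\<^bsub>Y\<^esub> h y \<in> carrier Y"
      using closed[OF x] closed[OF y] by (rule Y.join_closed)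
    obtain z where z: "z \<in> carrier X" "h z = h x \<squnion>\<^bsub>Y\<^esub> h y"
      by (rule bexE[OF preimage[OF hxy]])
    have "h x \<sqsubseteq>\<^bsub>Y\<^esub> h z" "h y \<sqsubseteq>\<^bsub>Y\<^esub> h z"
      unfolding z(2) by (rule Y.join_left[OF closed[OF x] closed[OF y]],
        rule Y.join_right[OF closed[OF x] closed[OF y]])
    then have "x \<sqsubseteq>\<^bsub>X\<^esub> z" "y \<sqsubseteq>\<^bsub>X\<^esub> z"
      unfolding le_iff[OF x z(1)] le_iff[OF y z(1)] .
    then have "x \<squnion>\<^bsub>X\<^esub> y \<sqsubseteq>\<^bsub>X\<^esub> z"
      using x y z(1) by (rule X.join_le)
    then have upper: "h (x \<squnion>\<^bsub>X\<^esub> y) \<sqsubseteq>\<^bsub>Y\<^esub> h x \<squnion>\<^bsub>Y\<^esub> h y"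
      unfolding z(2)[symmetric] le_iff[OF xy z(1)] .
    have "h x \<sqsubseteq>\<^bsub>Y\<^esub> h (x \<squnion>\<^bsub>X\<^esub> y)" "h y \<sqsubseteq>\<^bsub>Y\<^esub> h (x \<squnion>\<^bsub>X\<^esub> y)"
      unfolding le_iff[OF x xy] le_iff[OF y xy]
      by (rule X.join_left[OF x y], rule X.join_right[OF x y])
    then have lower: "h x \<squnion>\<^bsub>Y\<^esub> h y \<sqsubseteq>\<^bsub>Y\<^esub> h (x \<squnion>\<^bsub>X\<^esub> y)"
      using closed[OF x] closed[OF y] closed[OF xy] by (rule Y.join_le)
    show ?thesis
      by (rule Y.le_antisym[OF upper lower closed[OF xy] hxy])
  qed
  moreover have "h (x \<sqinter>\<^bsub>X\<^esub> y) = h x \<sqinter>\<^bsub>Y\<^esub> h y"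
    if x: "x \<in> carrier X" and y: "y \<in> carrier X" for x y
  proof -
    have xy: "x \<sqinter>\<^bsub>X\<^esub> y \<in> carrier X"
      using x y by (rule X.meet_closed)
    have hxy: "h x \<sqinter>\<^bsub>Y\<^esub> h y \<in> carrier Y"
      using closed[OF x] closed[OF y] by (rule Y.meet_closed)
    obtain z where z: "z \<in> carrier X" "h z = h x \<sqinter>\<^bsub>Y\<^esub> h y"
      by (rule bexE[OF preimage[OF hxy]])
    have "h z \<sqsubseteq>\<^bsub>Y\<^esub> h x" "h z \<sqsubseteq>\<^bsub>Y\<^esub> h y"
      unfolding z(2) by (rule Y.meet_left[OF closed[OF x] closed[OF y]],
        rule Y.meet_right[OF closed[OF x] closed[OF y]])
    then have "z \<sqsubseteq>\<^bsub>X\<^esub> x" "z \<sqsubseteq>\<^bsub>X\<^esub> y"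
      unfolding le_iff[OF z(1) x] le_iff[OF z(1) y] .
    then have "z \<sqsubseteq>\<^bsub>X\<^esub> x \<sqinter>\<^bsub>X\<^esub> y"
      using x y z(1) by (rule X.meet_le)
    then have lower: "h x \<sqinter>\<^bsub>Y\<^esub> h y \<sqsubseteq>\<^bsub>Y\<^esub> h (x \<sqinter>\<^bsub>X\<^esub> y)"
      unfolding z(2)[symmetric] le_iff[OF z(1) xy] .
    have "h (x \<sqinter>\<^bsub>X\<^esub> y) \<sqsubseteq>\<^bsub>Y\<^esub> h x" "h (x \<sqinter>\<^bsub>X\<^esub> y) \<sqsubseteq>\<^bsub>Y\<^esub> h y"
      unfolding le_iff[OF xy x] le_iff[OF xy y]
      by (rule X.meet_left[OF x y], rule X.meet_right[OF x y])
    then have upper: "h (x \<sqinter>\<^bsub>X\<^esub> y) \<sqsubseteq>\<^bsub>Y\<^esub> h x \<sqinter>\<^bsub>Y\<^esub> h y"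
      using closed[OF x] closed[OF y] closed[OF xy] by (rule Y.meet_le)
    show ?thesis
      by (rule Y.le_antisym[OF upper lower closed[OF xy] hxy])
  qed
  ultimately show ?thesis
    using X Y bij by (simp add: lattice_iso_def join_pres_def meet_pres_def)
qed

section \<open>Subracks of the corresponding quandle\<close>

text \<open>Subracks are unions of classes because \<open>\<sim>\<close> identifies only elements that lie in the same
  subracks.\<close>

lemma subrack_saturated:
  assumes Q: "Q \<in> subracks R f"
  shows "rack_rel R f `` Q \<subseteq> Q"
proof
  fix b assume "b \<in> rack_rel R f `` Q"
  then obtain a where a: "a \<in> Q" "gen_subrack R f a = gen_subrack R f b"
    by (auto simp: rack_rel_def)
  show "b \<in> Q"
    using gen_subrack_le[OF Q a(1)] gen_subrack_self[of b R f] a(2) by auto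
qed

lemma class_mem_quotient_iff:
  assumes r: "equiv A r" and a: "a \<in> A"
    and saturated: "r `` Q \<subseteq> Q"
  shows "r `` {a} \<in> Q // r \<longleftrightarrow> a \<in> Q"
proof
  assume "r `` {a} \<in> Q // r"
  then obtain b where b: "b \<in> Q" "r `` {a} = r `` {b}"
    by (rule quotientE)
  then have "(b, a) \<in> r"
    using eq_equiv_class[OF b(2)[symmetric] r a] by simp
  then show "a \<in> Q"
    using saturated b(1) by blast
qed (rule quotientI)

lemma quotient_Union:
  assumes r: "equiv A r" and X: "X \<subseteq> A // r"
  shows "(\<Union>X) // r = X"
proof -
  have "r `` {a} = C" if C: "C \<in> X" "a \<in> C" for a C
  proof -
    obtain b where b: "C = r `` {b}"
      using C(1) X by (meson quotientE subsetD)
    then show ?thesis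
      using equiv_class_eq[OF r, of b a] C(2) by simp
  qed
  moreover have "C \<noteq> {}" if "C \<in> X" for C
    using that X in_quotient_imp_non_empty[OF r] by blast
  ultimately show ?thesis
    by (fastforce simp: quotient_def)
qed

text \<open>Saturation turns \<open>[a] \<in> Q // \<sim>\<close> into \<open>a \<in> Q\<close>, and \<open>[a] * [b] = [f a b]\<close>; so both closure
  conditions of \<open>subracks_iff\<close>, read in the quotient on representatives, become the
  conditions for \<open>Q\<close>.\<close>

lemma saturated_subrack_iff:
  assumes R: "rack R f" and QR: "Q \<subseteq> R"
    and saturated: "rack_rel R f `` Q \<subseteq> Q"
  shows "Q // rack_rel R f \<in> subracks (quandle_carrier R f) (quandle_op R f)
    \<longleftrightarrow> Q \<in> subracks R f"
proof -
  let ?c = "\<lambda>a. rack_rel R f `` {a}"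
  have quotient_image: "S // rack_rel R f = ?c ` S" for S
    by (auto simp: quotient_def)
  have mem: "?c a \<in> ?c ` Q \<longleftrightarrow> a \<in> Q" if "a \<in> R" for a
    using class_mem_quotient_iff[OF equiv_rack_rel that saturated]
    by (simp add: quotient_image)
  have op: "quandle_op R f (?c a) (?c b) \<in> ?c ` Q \<longleftrightarrow> f a b \<in> Q" if "a \<in> R" "b \<in> R" for a b
    by (simp add: quandle_op_class[OF R that] mem rack_closed[OF R that])
  have rack_quotient: "rack (?c ` R) (quandle_op R f)"
    using quandle_quotient[OF R] by (simp add: quandle_def quandle_carrier_def quotient_image)
  have "?c ` Q \<in> subracks (?c ` R) (quandle_op R f) \<longleftrightarrow>
      (\<forall>a\<in>Q. \<forall>b\<in>Q. quandle_op R f (?c a) (?c b) \<in> ?c ` Q) \<and>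
      (\<forall>a\<in>Q. \<forall>b\<in>R. quandle_op R f (?c a) (?c b) \<in> ?c ` Q \<longrightarrow> ?c b \<in> ?c ` Q)"
    using image_mono[OF QR, of ?c] by (simp add: subracks_iff[OF rack_quotient])
  also have "\<dots> \<longleftrightarrow> Q \<in> subracks R f"
    using QR op mem unfolding subracks_iff[OF R] by (simp add: subset_iff)
  finally show ?thesis
    by (simp only: quandle_carrier_def quotient_image)
qed

theorem corollary2p7:
  fixes R :: "'a set" and f :: "'a \<Rightarrow> 'a \<Rightarrow> 'a"
  assumes "rack R f"
  shows "lattice_iso
           (subrack_lattice R f)
           (subrack_lattice (quandle_carrier R f) (quandle_op R f))
           (\<lambda>Q. Q // rack_rel R f)"
proof -
  let ?r = "rack_rel R f"
  have rack_quotient: "rack (quandle_carrier R f) (quandle_op R f)"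
    using quandle_quotient[OF assms] by (simp add: quandle_def)
  have mem: "?r `` {a} \<in> Q // ?r \<longleftrightarrow> a \<in> Q" if "Q \<in> subracks R f" "a \<in> R" for Q a
    by (rule class_mem_quotient_iff[OF equiv_rack_rel that(2) subrack_saturated[OF that(1)]])
  have subset_iff_quotient: "P // ?r \<subseteq> Q // ?r \<longleftrightarrow> P \<subseteq> Q"
    if P: "P \<in> subracks R f" and Q: "Q \<in> subracks R f" for P Q
  proof
    assume "P // ?r \<subseteq> Q // ?r"
    then have "a \<in> Q" if "a \<in> P" for a
      using mem[OF Q, of a] P quotientI[OF that, of ?r] that unfolding subracks_def by blast
    then show "P \<subseteq> Q"
      by (rule subsetI)
  next
    assume "P \<subseteq> Q"
    then show "P // ?r \<subseteq> Q // ?r"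
      unfolding quotient_def by blast
  qed
  have bij: "bij_betw (\<lambda>Q. Q // ?r) (subracks R f)
      (subracks (quandle_carrier R f) (quandle_op R f))"
  proof (rule bij_betw_imageI)
    show "inj_on (\<lambda>Q. Q // ?r) (subracks R f)"
    proof (rule inj_onI)
      fix P Q assume PQ: "P \<in> subracks R f" "Q \<in> subracks R f" and "P // ?r = Q // ?r"
      then show "P = Q"
        using subset_iff_quotient[OF PQ] subset_iff_quotient[OF PQ(2,1)] by simp
    qed
    show "(\<lambda>Q. Q // ?r) ` subracks R f = subracks (quandle_carrier R f) (quandle_op R f)"
    proof (intro equalityI subsetI)
      fix X assume "X \<in> (\<lambda>Q. Q // ?r) ` subracks R f"
      then obtain Q where Q: "Q \<in> subracks R f" "X = Q // ?r"
        by blast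
      then show "X \<in> subracks (quandle_carrier R f) (quandle_op R f)"
        using saturated_subrack_iff[OF assms _ subrack_saturated[OF Q(1)]]
        by (simp add: subracks_def)
    next
      fix X assume X: "X \<in> subracks (quandle_carrier R f) (quandle_op R f)"
      then have XR: "X \<subseteq> R // ?r"
        by (simp add: subracks_def quandle_carrier_def)
      have subset: "\<Union>X \<subseteq> R"
        using XR Union_quotient[OF equiv_rack_rel, of R f] by blast
      have saturated: "?r `` \<Union>X \<subseteq> \<Union>X"
      proof
        fix b assume "b \<in> ?r `` \<Union>X"
        then obtain C a where C: "C \<in> X" "a \<in> C" "(a, b) \<in> ?r"
          by blast
        then have "b \<in> C"
          using XR in_quotient_imp_closed[OF equiv_rack_rel] by (meson subsetD)
        then show "b \<in> \<Union>X"
          using C(1) by blast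
      qed
      have eq: "(\<Union>X) // ?r = X"
        by (rule quotient_Union[OF equiv_rack_rel XR])
      have "\<Union>X \<in> subracks R f"
        using saturated_subrack_iff[OF assms subset saturated] X by (simp add: eq)
      then show "X \<in> (\<lambda>Q. Q // ?r) ` subracks R f"
        by (rule rev_image_eqI) (rule eq[symmetric])
    qed
  qed
  show ?thesis
    by (rule order_iso_lattice_iso[OF lattice_subrack_lattice[OF assms]
          lattice_subrack_lattice[OF rack_quotient]])
      (use bij subset_iff_quotient in \<open>simp_all add: subrack_lattice_def\<close>)
qed

end
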